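(* There exists a constant $C > 0$ such that for all integers $n \ge 9$, $$\Delta_{9,7}(n) \le C\, n^{-\frac{23}{21}}.$$
   Context: For integers $k \ge d+1$ and $n \ge k$, $\Delta_{k,d}(n)$ denotes the minimum number $\Delta$ such that among any $n$ (distinct) points in $[0,1]^d$ there are $k$ points whose convex hull has $d$-dimensional volume at most $\Delta$. Here $k=9$ and $d=7$. *)

theory Defs
  imports "HOL-Analysis.Analysis"
begin

definition unit_cube :: "(real ^ 'd::finite) set" where
  "unit_cube = {x. \<forall>i. 0 \<le> x $ i \<and> x $ i \<le> 1}"

definition hull_volume :: "(real ^ 'd::finite) set \<Rightarrow> real" where
  "hull_volume S = measure lebesgue (convex hull S)"

definition heilbronn_bound :: "'d::finite itself \<Rightarrow> nat \<Rightarrow> nat \<Rightarrow> real \<Rightarrow> bool" where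
  "heilbronn_bound _ k n D \<longleftrightarrow>
     (\<forall>P :: (real ^ 'd) set. finite P \<longrightarrow> card P = n \<longrightarrow> P \<subseteq> unit_cube \<longrightarrow>
        (\<exists>S \<subseteq> P. card S = k \<and> hull_volume S \<le> D))"

text \<open>
  The dimension \<open>d\<close> is \<open>CARD('d)\<close>, passed as \<open>TYPE('d)\<close>. On the reals, \<open>LEAST\<close> is
  unspecified when no minimum exists; by \<open>heilbronn_Delta_least\<close> below the minimum
  does exist whenever \<open>k \<le> n\<close>.
\<close>

definition heilbronn_Delta :: "'d::finite itself \<Rightarrow> nat \<Rightarrow> nat \<Rightarrow> real" where
  "heilbronn_Delta d k n = (LEAST D. heilbronn_bound d k n D)"

lemma unit_cube_eq_cbox: "unit_cube = cbox (0 :: real ^ 'd::finite) (\<chi> i. 1)"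
  by (auto simp: unit_cube_def mem_box_cart)

lemma convex_unit_cube: "convex (unit_cube :: (real ^ 'd::finite) set)"
  by (simp add: unit_cube_eq_cbox)

lemma infinite_unit_cube: "infinite (unit_cube :: (real ^ 'd::finite) set)"
proof -
  have "inj_on (\<lambda>t. \<chi> i. t :: real ^ 'd) {0..1::real}"
    by (auto simp: inj_on_def vec_eq_iff)
  moreover have "(\<lambda>t. \<chi> i. t :: real ^ 'd) ` {0..1::real} \<subseteq> unit_cube"
    by (auto simp: unit_cube_def)
  ultimately show ?thesis
    by (metis finite_subset finite_imageD infinite_Icc zero_less_one)
qed

lemma hull_volume_le:
  assumes "S \<subseteq> (unit_cube :: (real ^ 'd::finite) set)" "finite S"
  shows "hull_volume S \<le> measure lebesgue (unit_cube :: (real ^ 'd) set)"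
proof -
  have "convex hull S \<subseteq> unit_cube"
    using assms by (simp add: convex_unit_cube hull_minimal)
  moreover have "convex hull S \<in> sets lebesgue"
    using assms by (simp add: finite_imp_compact_convex_hull lmeasurable_compact fmeasurableD)
  moreover have "(unit_cube :: (real ^ 'd) set) \<in> fmeasurable lebesgue"
    by (simp add: unit_cube_eq_cbox)
  ultimately show ?thesis
    unfolding hull_volume_def by (intro measure_mono_fmeasurable)
qed

lemma heilbronn_min_exists:
  assumes "k \<le> n"
  shows "\<exists>D. heilbronn_bound (d :: 'd::finite itself) k n D \<and>
             (\<forall>D'. heilbronn_bound d k n D' \<longrightarrow> D \<le> D')"
proof -
  define conf where
    "conf = {P :: (real ^ 'd) set. finite P \<and> card P = n \<and> P \<subseteq> unit_cube}"
  define f where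
    "f P = Min (hull_volume ` {S. S \<subseteq> P \<and> card S = k})" for P :: "(real ^ 'd) set"
  have fin: "finite {S. S \<subseteq> P \<and> card S = k}" if "P \<in> conf" for P
    using that by (simp add: conf_def)
  have ne: "{S. S \<subseteq> P \<and> card S = k} \<noteq> {}" if "P \<in> conf" for P
    using that assms by (auto simp: conf_def) (metis obtain_subset_with_card_n)
  have f_le: "(\<exists>S\<subseteq>P. card S = k \<and> hull_volume S \<le> D) \<longleftrightarrow> f P \<le> D"
    if "P \<in> conf" for P D
    unfolding f_def using fin[OF that] ne[OF that] by (subst Min_le_iff) auto
  have bound: "heilbronn_bound d k n D \<longleftrightarrow> (\<forall>P\<in>conf. f P \<le> D)" for D
    unfolding heilbronn_bound_def using f_le by (auto simp: conf_def)
  obtain P0 where "P0 \<in> conf"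
    unfolding conf_def using infinite_arbitrarily_large[OF infinite_unit_cube] by blast
  then have "conf \<noteq> {}" by blast
  have "f P \<le> measure lebesgue (unit_cube :: (real ^ 'd) set)" if P: "P \<in> conf" for P
  proof -
    obtain S where "S \<subseteq> P" "card S = k" using ne[OF P] by blast
    moreover have "hull_volume S \<le> measure lebesgue (unit_cube :: (real ^ 'd) set)"
      using P \<open>S \<subseteq> P\<close> by (intro hull_volume_le) (auto simp: conf_def intro: finite_subset)
    ultimately show ?thesis using f_le[OF P] by blast
  qed
  then have "bdd_above (f ` conf)" by (rule bdd_aboveI2)
  with \<open>conf \<noteq> {}\<close> show ?thesis
    unfolding bound by (intro exI[of _ "Sup (f ` conf)"]) (auto intro: cSUP_upper cSUP_least)
qed

lemma heilbronn_Delta_least: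
  assumes "k \<le> n"
  shows "heilbronn_bound (d :: 'd::finite itself) k n (heilbronn_Delta d k n)"
    and "heilbronn_bound d k n D \<Longrightarrow> heilbronn_Delta d k n \<le> D"
proof -
  obtain m where m: "heilbronn_bound d k n m" "\<And>D. heilbronn_bound d k n D \<Longrightarrow> m \<le> D"
    using heilbronn_min_exists[OF assms] by blast
  then have "heilbronn_Delta d k n = m"
    unfolding heilbronn_Delta_def by (intro Least_equality)
  with m show "heilbronn_bound d k n (heilbronn_Delta d k n)"
    and "heilbronn_bound d k n D \<Longrightarrow> heilbronn_Delta d k n \<le> D" by auto
qed

end

theory Submission
  imports Defs
begin

text \<open>
  Let \<open>d \<ge> 4\<close>. Among any \<open>n\<close> points of the unit cube of dimension \<open>d\<close> there are \<open>d + 2\<close> whose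
  convex hull has volume \<open>O(n powr -(1 + 1 / d))\<close>. For \<open>d = 7\<close> this exponent is \<open>8 / 7 = 24 / 21\<close>,
  which is better than \<open>23 / 21\<close>.

  The two factors \<open>n powr -(1 / d)\<close> and \<open>1 / n\<close> come from two independent pigeonhole arguments.

  \<^item> A grid gives three points \<open>p, p1, p2\<close> at mutual distance \<open>\<delta> = O(n powr -(1 / d))\<close>
    (\<open>clustered_points\<close>).

  \<^item> As \<open>d \<ge> 4\<close>, there are orthonormal vectors \<open>a, b\<close> perpendicular to \<open>p1 - p\<close> and \<open>p2 - p\<close>. The unit
    vectors \<open>w = cos \<theta> a + sin \<theta> b\<close> are normals of a pencil of hyperplanes, all of which contain the
    three points. Each remaining point lies on some hyperplane of the pencil, so \<open>d - 1\<close> of them have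
    angles within \<open>O(1 / n)\<close> of each other and hence lie within \<open>\<epsilon> = O(1 / n)\<close> of a single hyperplane
    of the pencil (\<open>points_near_pencil_hyperplane\<close>).

  The three clustered points and these \<open>d - 1\<close> points are the desired \<open>d + 2\<close> points. By
  Caratheodory's theorem their hull is the union of the \<open>d + 2\<close> simplices obtained by omitting one
  point (\<open>hull_volume_le_sum_remove\<close>). Three clustered points are needed because
  each of these simplices must still contain two of them. Such a simplex has an edge of
  length at most \<open>\<delta>\<close> that is parallel to the hyperplane, while all its vertices are within \<open>\<epsilon>\<close> of the
  hyperplane. The determinant that computes its volume is therefore \<open>O(\<delta> \<epsilon>)\<close>
  (\<open>hull_volume_simplex_le\<close>): each of its Leibniz terms contains a factor from the short edge and a
  factor from the direction of \<open>w\<close>, and these are never the same nonzero entry.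
\<close>

section \<open>Pigeonhole arguments\<close>

lemma many_in_one_fibre:
  assumes "finite A" "finite B" "f \<in> A \<rightarrow> B" "t * card B < card A"
  obtains T where "T \<subseteq> A" "card T = Suc t" "\<And>x y. x \<in> T \<Longrightarrow> y \<in> T \<Longrightarrow> f x = f y"
proof -
  have "B \<noteq> {}" using assms(3,4) by (cases "A = {}") auto
  then obtain y where y: "card A \<le> card (f -` {y} \<inter> A) * card B"
    using pigeonhole_card[OF assms(3,1,2)] by blast
  then have "t * card B < card (f -` {y} \<inter> A) * card B" using assms(4) by linarith
  then have "Suc t \<le> card (f -` {y} \<inter> A)" by simp
  then obtain T where "T \<subseteq> f -` {y} \<inter> A" "card T = Suc t"
    by (metis obtain_subset_with_card_n)
  then show thesis by (intro that[of T]) auto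
qed

text \<open>
  The index of the interval of length \<open>1 / m\<close> that contains \<open>t\<close>, for \<open>t\<close> in the closed unit interval;
  the minimum puts the endpoint 1 into the last interval, so that there are only \<open>m\<close> values.
\<close>

definition cell :: "nat \<Rightarrow> real \<Rightarrow> nat" where
  "cell m t = min (m - 1) (nat \<lfloor>real m * t\<rfloor>)"

lemma cell_less: "0 < m \<Longrightarrow> cell m t < m"
  by (simp add: cell_def)

lemma cell_bounds:
  assumes "0 < m" "0 \<le> t" "t \<le> 1"
  shows "real (cell m t) \<le> real m * t" "real m * t \<le> real (cell m t) + 1"
proof -
  have nn: "0 \<le> real m * t" and le: "real m * t \<le> real m"
    using assms by (simp_all add: mult_left_le)
  have fl: "real (nat \<lfloor>real m * t\<rfloor>) \<le> real m * t" "real m * t \<le> real (nat \<lfloor>real m * t\<rfloor>) + 1"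
    using nn by linarith+
  show "real (cell m t) \<le> real m * t" using fl(1) unfolding cell_def by linarith
  have "real m = real (m - 1) + 1" using assms by simp
  moreover have "cell m t = m - 1 \<or> cell m t = nat \<lfloor>real m * t\<rfloor>"
    by (auto simp: cell_def min_def)
  ultimately show "real m * t \<le> real (cell m t) + 1"
    using fl(2) le by presburger
qed

lemma same_cell_close:
  assumes "0 < m" "s \<in> {0..1}" "t \<in> {0..1}" "cell m s = cell m t"
  shows "\<bar>s - t\<bar> \<le> 1 / real m"
proof -
  have "\<bar>real m * s - real m * t\<bar> \<le> 1"
    using cell_bounds[of m s] cell_bounds[of m t] assms by auto
  then have "real m * \<bar>s - t\<bar> \<le> 1" by (simp add: abs_mult flip: right_diff_distrib)
  then show ?thesis using assms(1) by (simp add: field_simps)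
qed

text \<open>
  The number of cells in both pigeonhole arguments: below the threshold \<open>x\<close> that keeps the cells
  crowded, but at least half of it, so that the cells are as small as the threshold permits
  up to a factor 2.
\<close>

lemma nat_below_real:
  assumes "1 < (x::real)"
  obtains m :: nat where "0 < m" "real m < x" "1 / real m \<le> 2 / x"
proof -
  define m where "m = nat (\<lceil>x\<rceil> - 1)"
  have "1 \<le> \<lceil>x\<rceil> - 1" using assms by linarith
  then have m: "1 \<le> m" and eq: "real m = of_int \<lceil>x\<rceil> - 1"
    unfolding m_def by linarith+
  have lt: "real m < x" and le: "x \<le> real m + 1" using eq by linarith+
  moreover have "x \<le> 2 * real m" using m le by simp
  with m assms have "1 / real m \<le> 2 / x" by (simp add: field_simps)
  ultimately show thesis using m(1) by (intro that[of m]) simp_all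
qed

text \<open>
  Divide the cube into \<open>m ^ d\<close> congruent cubes, where \<open>m\<close> is about \<open>(n / t) powr (1 / d)\<close> for \<open>n\<close> points;
  one of them contains more than \<open>t\<close> points.
\<close>

lemma clustered_points:
  fixes P :: "(real ^ 'd::finite) set"
  assumes "finite P" "P \<subseteq> unit_cube" "0 < t" "t < card P"
  obtains T where "T \<subseteq> P" "card T = Suc t"
    "\<And>x y. x \<in> T \<Longrightarrow> y \<in> T \<Longrightarrow>
       dist x y \<le> 2 * real CARD('d) * (real (card P) / real t) powr (- (1 / real CARD('d)))"
proof -
  define d where "d = CARD('d)"
  have d: "0 < d" by (simp add: d_def)
  define r where "r = real (card P) / real t"
  have r: "1 < r" using assms by (simp add: r_def)
  obtain m where m: "0 < m" "real m < r powr (1 / real d)" "1 / real m \<le> 2 / (r powr (1 / real d))"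
    using nat_below_real[of "r powr (1 / real d)"] r d by auto
  define g where "g x = (\<lambda>i. cell m (x $ i))" for x :: "(real, 'd) vec"
  have "real m ^ d < (r powr (1 / real d)) ^ d"
    using m d by (intro power_strict_mono) auto
  also have "\<dots> = r" using r d by (simp add: powr_power)
  finally have "real t * real m ^ d < real (card P)"
    using assms(3) by (simp add: r_def field_simps)
  then have "real (t * m ^ d) < real (card P)" by simp
  then have cnt: "t * card (UNIV \<rightarrow>\<^sub>E {..<m} :: ('d \<Rightarrow> nat) set) < card P"
    by (subst card_funcsetE) (simp_all add: d_def del: of_nat_mult of_nat_power)
  have "g \<in> P \<rightarrow> (UNIV \<rightarrow>\<^sub>E {..<m})" using m(1) by (auto simp: g_def cell_less)
  moreover have "finite (UNIV \<rightarrow>\<^sub>E {..<m} :: ('d \<Rightarrow> nat) set)" by (intro finite_PiE) auto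
  ultimately obtain T where T: "T \<subseteq> P" "card T = Suc t"
    "\<And>x y. x \<in> T \<Longrightarrow> y \<in> T \<Longrightarrow> g x = g y"
    using many_in_one_fibre[OF assms(1) _ _ cnt] by metis
  have "dist x y \<le> 2 * real d * r powr (- (1 / real d))" if xy: "x \<in> T" "y \<in> T" for x y
  proof -
    have "\<bar>(x - y) $ i\<bar> \<le> 1 / real m" for i
    proof -
      have "cell m (x $ i) = cell m (y $ i)" using T(3)[OF xy] by (metis g_def)
      moreover have "x $ i \<in> {0..1}" "y $ i \<in> {0..1}"
        using xy T(1) assms(2) by (auto simp: unit_cube_def)
      ultimately show ?thesis using same_cell_close m(1) by simp
    qed
    then have "(\<Sum>i\<in>UNIV. \<bar>(x - y) $ i\<bar>) \<le> (\<Sum>i\<in>(UNIV::'d set). 1 / real m)"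
      by (intro sum_mono)
    then have "dist x y \<le> real d * (1 / real m)"
      using norm_le_l1_cart[of "x - y"] by (simp add: dist_norm d_def)
    also have "\<dots> \<le> real d * (2 / (r powr (1 / real d)))"
      using m(3) by (intro mult_left_mono) auto
    finally show ?thesis by (simp add: powr_minus divide_inverse)
  qed
  then show thesis using that T by (simp add: r_def d_def)
qed

text \<open>
  With \<open>(b \<bullet> v, - (a \<bullet> v)) = r (cos \<phi>, sin \<phi>)\<close> in polar coordinates, the inner product of
  \<open>cos \<theta> a + sin \<theta> b\<close> and \<open>v\<close> equals \<open>r sin (\<theta> - \<phi>)\<close>. Thus \<open>\<phi>\<close> is the angle of the hyperplane of the
  pencil that contains \<open>v\<close>, and \<open>v\<close> is close to the hyperplanes whose angle is close to \<open>\<phi>\<close>.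
\<close>

lemma pencil_inner_le_angle:
  fixes a b v :: "'a::real_inner"
  assumes "norm a = 1" "norm b = 1"
  shows "\<bar>(cos \<theta> *\<^sub>R a + sin \<theta> *\<^sub>R b) \<bullet> v\<bar>
    \<le> 2 * norm v * \<bar>\<theta> - Arg (Complex (b \<bullet> v) (- (a \<bullet> v)))\<bar>"
proof -
  define z where "z = Complex (b \<bullet> v) (- (a \<bullet> v))"
  have re: "b \<bullet> v = cmod z * cos (Arg z)" and im: "- (a \<bullet> v) = cmod z * sin (Arg z)"
    using rcis_cmod_Arg[of z] by (metis Re_rcis z_def complex.sel(1), metis Im_rcis z_def complex.sel(2) rcis_cmod_Arg)
  have a: "a \<bullet> v = - (cmod z * sin (Arg z))" using im by linarith
  have "(cos \<theta> *\<^sub>R a + sin \<theta> *\<^sub>R b) \<bullet> v = cmod z * sin (\<theta> - Arg z)"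
    unfolding inner_add_left inner_scaleR_left a re by (simp add: sin_diff algebra_simps)
  moreover have "cmod z \<le> 2 * norm v"
    using cmod_le[of z] Cauchy_Schwarz_ineq2[of a v] Cauchy_Schwarz_ineq2[of b v] assms
    by (simp add: z_def)
  ultimately show ?thesis
    unfolding z_def[symmetric]
    using abs_sin_x_le_abs_x[of "\<theta> - Arg z"] by (simp add: abs_mult mult_mono)
qed

text \<open>
  Assign to each \<open>q\<close> the angle of the hyperplane of the pencil through \<open>p\<close> that contains \<open>q\<close>, and
  divide the range of angles into about \<open>card Q / t\<close> intervals. More than \<open>t\<close> points have their angle in
  the same interval, and the angle of any one of them serves as \<open>\<theta>\<close>.
\<close>

lemma points_near_pencil_hyperplane:
  fixes a b p :: "'a::real_inner"
  assumes ab: "norm a = 1" "norm b = 1"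
    and Q: "finite Q" "\<And>q. q \<in> Q \<Longrightarrow> norm (q - p) \<le> B"
    and t: "0 < t" "t < card Q"
  obtains T \<theta> where "T \<subseteq> Q" "card T = Suc t"
    "\<And>q. q \<in> T \<Longrightarrow>
       \<bar>(cos \<theta> *\<^sub>R a + sin \<theta> *\<^sub>R b) \<bullet> (q - p)\<bar> \<le> 8 * pi * B * real t / real (card Q)"
proof -
  define arg where "arg q = Arg (Complex (b \<bullet> (q - p)) (- (a \<bullet> (q - p))))" for q
  define f where "f q = (arg q + pi) / (2 * pi)" for q
  have f: "f q \<in> {0..1}" for q
    using Arg_bounded[of "Complex (b \<bullet> (q - p)) (- (a \<bullet> (q - p)))"]
    by (auto simp: f_def arg_def divide_simps)
  have "1 < real (card Q) / real t" using t by simp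
  then obtain m where m: "0 < m" "real m < real (card Q) / real t"
    "1 / real m \<le> 2 / (real (card Q) / real t)"
    by (rule nat_below_real)
  have "real t * real m < real (card Q)" using m(2) t by (simp add: field_simps)
  then have "t * card {..<m} < card Q" by (simp flip: of_nat_mult)
  moreover have "(\<lambda>q. cell m (f q)) \<in> Q \<rightarrow> {..<m}" using m(1) by (simp add: cell_less)
  ultimately obtain T where T: "T \<subseteq> Q" "card T = Suc t"
    "\<And>x y. x \<in> T \<Longrightarrow> y \<in> T \<Longrightarrow> cell m (f x) = cell m (f y)"
    using many_in_one_fibre[OF Q(1) finite_lessThan] by metis
  then obtain q0 where q0: "q0 \<in> T" by fastforce
  have "\<bar>(cos (arg q0) *\<^sub>R a + sin (arg q0) *\<^sub>R b) \<bullet> (q - p)\<bar> \<le> 8 * pi * B * real t / real (card Q)"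
    if q: "q \<in> T" for q
  proof -
    have "\<bar>f q0 - f q\<bar> \<le> 1 / real m"
      using same_cell_close[OF m(1) f f T(3)[OF q0 q]] .
    moreover have "f q0 - f q = (arg q0 - arg q) / (2 * pi)"
      by (simp add: f_def diff_divide_distrib add_divide_distrib)
    ultimately have "\<bar>arg q0 - arg q\<bar> / (2 * pi) \<le> 2 / (real (card Q) / real t)"
      using m(3) by simp
    then have ang: "\<bar>arg q0 - arg q\<bar> \<le> 4 * pi * real t / real (card Q)"
      by (simp add: pos_divide_le_eq algebra_simps)
    have B: "norm (q - p) \<le> B" using q T(1) Q(2) by blast
    then have "0 \<le> B" using norm_ge_zero[of "q - p"] by linarith
    have "\<bar>(cos (arg q0) *\<^sub>R a + sin (arg q0) *\<^sub>R b) \<bullet> (q - p)\<bar>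
        \<le> 2 * norm (q - p) * \<bar>arg q0 - arg q\<bar>"
      using pencil_inner_le_angle[OF ab] unfolding arg_def .
    also have "\<dots> \<le> 2 * B * (4 * pi * real t / real (card Q))"
      using B ang \<open>0 \<le> B\<close> by (intro mult_mono) auto
    finally show ?thesis by (simp add: algebra_simps)
  qed
  then show thesis using that T by blast
qed

section \<open>Volume of thin simplices and hulls\<close>

text \<open>
  A Leibniz term takes one entry from row \<open>k\<close> and one from column \<open>j0\<close>. If they coincide, it contains
  the entry 0; otherwise it contains a factor at most \<open>\<epsilon>\<close> and another factor at most \<open>\<delta>\<close>.
\<close>

lemma abs_det_le_zero_small_entry:
  fixes A :: "real ^ 'n::finite ^ 'n"
  assumes row: "A $ k $ j0 = 0"
    and small: "\<And>j. \<bar>A $ k $ j\<bar> \<le> \<epsilon>"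
    and col: "\<And>i. \<bar>A $ i $ j0\<bar> \<le> \<delta>"
    and B: "\<And>i j. \<bar>A $ i $ j\<bar> \<le> B"
  shows "\<bar>det A\<bar> \<le> fact CARD('n) * (\<epsilon> * \<delta> * B ^ (CARD('n) - 2))"
proof -
  let ?c = "\<epsilon> * \<delta> * B ^ (CARD('n) - 2)"
  have nn: "0 \<le> \<epsilon>" "0 \<le> \<delta>" "0 \<le> B"
    using small[of j0] col[of k] B[of k k] by linarith+
  have summand: "\<bar>of_int (sign p) * (\<Prod>i\<in>UNIV. A $ i $ p i)\<bar> \<le> ?c" if p: "p permutes UNIV" for p
  proof (cases "p k = j0")
    case True
    then have "(\<Prod>i\<in>UNIV. A $ i $ p i) = 0" using row by (intro prod_zero) auto
    moreover have "0 \<le> ?c" using nn by simp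
    ultimately show ?thesis by (simp only: mult_zero_right abs_zero)
  next
    case False
    obtain l where l: "p l = j0" using p by (metis permutes_surj surj_def)
    with False have "l \<noteq> k" by blast
    let ?R = "UNIV - {k} - {l}"
    have "(\<Prod>i\<in>UNIV. \<bar>A $ i $ p i\<bar>) = \<bar>A $ k $ p k\<bar> * (\<bar>A $ l $ j0\<bar> * (\<Prod>i\<in>?R. \<bar>A $ i $ p i\<bar>))"
      using l \<open>l \<noteq> k\<close> by (simp add: prod.remove[of UNIV k] prod.remove[of "UNIV - {k}" l])
    also have "\<dots> \<le> \<epsilon> * (\<delta> * (\<Prod>i\<in>?R. B))"
      using nn small col B by (intro mult_mono prod_mono mult_nonneg_nonneg prod_nonneg) auto
    also have "(\<Prod>i\<in>?R. B) = B ^ (CARD('n) - 2)"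
      using \<open>l \<noteq> k\<close> by (simp add: card_Diff_singleton numeral_2_eq_2)
    finally have "(\<Prod>i\<in>UNIV. \<bar>A $ i $ p i\<bar>) \<le> ?c" by (simp add: mult.assoc)
    moreover have "\<bar>real_of_int (sign p)\<bar> = 1" by (simp add: sign_def)
    ultimately show ?thesis by (simp add: abs_mult abs_prod)
  qed
  have "\<bar>det A\<bar> \<le> (\<Sum>p | p permutes (UNIV :: 'n set). ?c)"
    unfolding det_def using summand by (intro order_trans[OF sum_abs] sum_mono) auto
  also have "\<dots> = fact CARD('n) * ?c"
    using card_permutations[of "UNIV :: 'n set" "CARD('n)"] by simp
  finally show ?thesis .
qed

text \<open>
  The matrix whose columns are the edges from \<open>x\<close> is multiplied by an orthogonal matrix that moves \<open>w\<close>
  to a coordinate axis. In the result the edge to \<open>y\<close> is a column with entries at most \<open>\<delta>\<close>, the inner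
  products with \<open>w\<close> form a row with entries at most \<open>\<epsilon>\<close>, and the two meet in the entry 0. The factorial
  from the number of Leibniz terms cancels against the one in the volume formula of a simplex.
\<close>

lemma hull_volume_simplex_le:
  fixes X :: "(real, 'd::{finite,wellorder}) vec set" and w :: "(real, 'd) vec"
  assumes X: "finite X" "card X = Suc CARD('d)"
    and xy: "x \<in> X" "y \<in> X" "x \<noteq> y" "dist x y \<le> \<delta>"
    and w: "norm w = 1" "w \<bullet> (y - x) = 0" "\<And>z. z \<in> X \<Longrightarrow> \<bar>w \<bullet> (z - x)\<bar> \<le> \<epsilon>"
    and B: "\<And>z. z \<in> X \<Longrightarrow> norm (z - x) \<le> B"
  shows "hull_volume X \<le> \<epsilon> * \<delta> * B ^ (CARD('d) - 2)"
proof -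
  obtain f where f: "bij_betw f (UNIV :: 'd set) (X - {x})"
    using X xy(1) finite_same_card_bij[of "UNIV :: 'd set" "X - {x}"] by auto
  have fX: "f j \<in> X" for j using f by (auto simp: bij_betw_def)
  define M :: "((real, 'd) vec, 'd) vec" where "M = (\<chi> i j. f j $ i - x $ i)"
  have "y \<in> range f" using f xy by (simp add: bij_betw_def)
  then obtain j0 where j0: "f j0 = y" by auto
  \<comment> \<open>Any axis can be the image of \<open>w\<close>; rows and columns are indexed by the same type, so \<open>j0\<close> will do.\<close>
  define k where "k = j0"
  obtain U :: "(real, 'd) vec \<Rightarrow> (real, 'd) vec" where U: "orthogonal_transformation U" "U w = axis k 1"
    using orthogonal_transformation_exists_1[OF w(1), of "axis k 1"] by auto
  define A where "A = matrix U ** M"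
  have entry: "A $ i $ j = U (f j - x) $ i" for i j
  proof -
    have "M *v axis j 1 = f j - x"
      by (simp add: M_def matrix_vector_mult_basis column_def vec_eq_iff)
    then have "A *v axis j 1 = U (f j - x)"
      using U(1) by (simp add: A_def orthogonal_transformation_linear flip: matrix_vector_mul_assoc)
    then show ?thesis by (simp add: matrix_vector_mult_basis column_def vec_eq_iff)
  qed
  have krow: "A $ k $ j = w \<bullet> (f j - x)" for j
  proof -
    have "A $ k $ j = axis k 1 \<bullet> U (f j - x)" by (simp add: entry inner_axis')
    also have "\<dots> = w \<bullet> (f j - x)" using U by (metis orthogonal_transformation_def)
    finally show ?thesis .
  qed
  have le: "\<bar>A $ i $ j\<bar> \<le> norm (f j - x)" for i j
    using component_le_norm_cart[of "U (f j - x)" i] U(1)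
    by (simp add: entry orthogonal_transformation_norm)
  have "\<bar>det A\<bar> \<le> fact CARD('d) * (\<epsilon> * \<delta> * B ^ (CARD('d) - 2))"
  proof (rule abs_det_le_zero_small_entry)
    show "A $ k $ j0 = 0" by (simp add: krow j0 w)
    show "\<bar>A $ k $ j\<bar> \<le> \<epsilon>" for j using w(3) fX by (simp add: krow)
    show "\<bar>A $ i $ j0\<bar> \<le> \<delta>" for i
      using le[of i j0] xy(4) by (simp add: j0 dist_norm norm_minus_commute)
    show "\<bar>A $ i $ j\<bar> \<le> B" for i j using le[of i j] B[OF fX[of j]] by linarith
  qed
  moreover have "\<bar>det A\<bar> = \<bar>det M\<bar>" using U(1) by (simp add: A_def det_mul abs_mult)
  moreover have "hull_volume X = \<bar>det M\<bar> / fact CARD('d)"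
    using content_simplex[OF X xy(1) f] X(1)
    by (simp add: hull_volume_def M_def measure_completion finite_imp_compact_convex_hull
        compact_imp_closed)
  ultimately show ?thesis by (simp add: divide_le_eq mult.commute)
qed

lemma hull_volume_le_sum_remove:
  fixes S :: "(real ^ 'd::finite) set"
  assumes "finite S" "card S = CARD('d) + 2"
  shows "hull_volume S \<le> (\<Sum>x\<in>S. hull_volume (S - {x}))"
proof -
  have hull: "convex hull S = (\<Union>x\<in>S. convex hull (S - {x}))"
  proof
    show "convex hull S \<subseteq> (\<Union>x\<in>S. convex hull (S - {x}))"
    proof
      fix z assume "z \<in> convex hull S"
      then obtain T where T: "T \<subseteq> S" "card T \<le> CARD('d) + 1" "z \<in> convex hull T"
        unfolding caratheodory[of S] by auto
      then have "T \<noteq> S" using assms(2) by auto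
      then obtain x where "x \<in> S" "x \<notin> T" using T(1) by blast
      then have "T \<subseteq> S - {x}" using T(1) by blast
      then show "z \<in> (\<Union>x\<in>S. convex hull (S - {x}))" using T(3) \<open>x \<in> S\<close> hull_mono by blast
    qed
    show "(\<Union>x\<in>S. convex hull (S - {x})) \<subseteq> convex hull S"
      by (intro UN_least hull_mono) blast
  qed
  show ?thesis unfolding hull_volume_def hull
    using assms(1) by (intro measure_UNION_le)
      (auto intro!: fmeasurableD lmeasurable_compact finite_imp_compact_convex_hull)
qed

text \<open>
  Omitting one point leaves a simplex with two vertices \<open>x, y\<close> in the cluster \<open>P\<close>. As \<open>P\<close> lies on the
  hyperplane through \<open>p\<close> with normal \<open>w\<close>, the base point \<open>p\<close> may be replaced by \<open>x\<close> in the slab condition,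
  which matters when \<open>p\<close> itself is omitted.
\<close>

lemma hull_volume_slab_cluster_le:
  fixes P Q :: "(real, 'd::{finite,wellorder}) vec set" and w :: "(real, 'd) vec"
  assumes P: "card P = 3" "p \<in> P" and Q: "finite Q" "card Q = CARD('d) - 1" "P \<inter> Q = {}" "2 \<le> CARD('d)"
    and close: "\<And>x y. x \<in> P \<Longrightarrow> y \<in> P \<Longrightarrow> dist x y \<le> \<delta>"
    and w: "norm w = 1" "\<And>x. x \<in> P \<Longrightarrow> w \<bullet> (x - p) = 0"
      "\<And>q. q \<in> Q \<Longrightarrow> \<bar>w \<bullet> (q - p)\<bar> \<le> \<epsilon>"
    and \<epsilon>: "0 \<le> \<epsilon>"
    and B: "\<And>x y. x \<in> P \<union> Q \<Longrightarrow> y \<in> P \<union> Q \<Longrightarrow> norm (x - y) \<le> B"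
  shows "hull_volume (P \<union> Q) \<le> real (CARD('d) + 2) * (\<epsilon> * \<delta> * B ^ (CARD('d) - 2))"
proof -
  let ?S = "P \<union> Q"
  have fP: "finite P" using P(1) by (metis card.infinite zero_neq_numeral)
  have S: "finite ?S" "card ?S = CARD('d) + 2"
    using fP P(1) Q by (simp_all add: card_Un_disjoint)
  have "hull_volume (?S - {s}) \<le> \<epsilon> * \<delta> * B ^ (CARD('d) - 2)" if s: "s \<in> ?S" for s
  proof -
    have "1 < card (P - {s})" using P(1) fP by (simp add: card_Diff_singleton_if)
    then obtain x y where xy: "x \<in> P - {s}" "y \<in> P - {s}" "x \<noteq> y"
      using card_le_Suc0_iff_eq[of "P - {s}"] fP by (metis finite_Diff not_less One_nat_def)
    have shift: "w \<bullet> (z - x) = w \<bullet> (z - p)" for z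
      using w(2)[of x] xy(1) by (simp add: inner_diff_right)
    show ?thesis
    proof (rule hull_volume_simplex_le[of _ x y _ w])
      show "finite (?S - {s})" using S by simp
      show "card (?S - {s}) = Suc CARD('d)" using S s by (simp add: card_Diff_singleton)
      show "x \<in> ?S - {s}" "y \<in> ?S - {s}" "x \<noteq> y" "dist x y \<le> \<delta>" "norm w = 1"
        using xy close w by auto
      show "w \<bullet> (y - x) = 0" using w(2) xy by (simp add: shift)
      show "\<bar>w \<bullet> (z - x)\<bar> \<le> \<epsilon>" if "z \<in> ?S - {s}" for z
        using that w(2,3) \<epsilon> by (auto simp: shift)
      show "norm (z - x) \<le> B" if "z \<in> ?S - {s}" for z using that xy B by blast
    qed
  qed
  then have "(\<Sum>s\<in>?S. hull_volume (?S - {s})) \<le> real (card ?S) * (\<epsilon> * \<delta> * B ^ (CARD('d) - 2))"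
    by (rule sum_bounded_above)
  with hull_volume_le_sum_remove[OF S] S(2) show ?thesis by simp
qed

section \<open>Heilbronn bound for one point more than a simplex\<close>

lemma exists_unit_orthogonal:
  fixes S :: "'a::euclidean_space set"
  assumes "finite S" "card S < DIM('a)"
  obtains a where "norm a = 1" "\<And>s. s \<in> S \<Longrightarrow> a \<bullet> s = 0"
proof -
  have "dim S < DIM('a)" using dim_le_card'[OF assms(1)] assms(2) by linarith
  then obtain x where "x \<noteq> 0" "\<And>y. y \<in> span S \<Longrightarrow> orthogonal x y"
    using orthogonal_to_subspace_exists[of S] by blast
  then show thesis
    by (intro that[of "x /\<^sub>R norm x"]) (auto simp: orthogonal_def span_base)
qed

text \<open>
  The condition on the dimension makes room for two orthonormal vectors perpendicular to the two
  differences within the cluster.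
\<close>

theorem heilbronn_Delta_le:
  assumes d4: "4 \<le> CARD('d::{finite,wellorder})"
  shows "\<exists>C>0. \<forall>n \<ge> CARD('d) + 2.
    heilbronn_Delta TYPE('d) (CARD('d) + 2) n \<le> C * real n powr (- (1 + 1 / real CARD('d)))"
proof -
  define d where "d = CARD('d)"
  define B where "B = real d"
  define C where "C = real (d + 2) * (16 * pi * B * d * (4 * real d) * B ^ (d - 2))"
  have d4': "4 \<le> d" using d4 by (simp add: d_def)
  have "0 < C" using d4' by (simp add: C_def B_def)
  moreover have "heilbronn_Delta TYPE('d) (d + 2) n \<le> C * real n powr (- (1 + 1 / real d))"
    if n: "d + 2 \<le> n" for n
  proof (rule heilbronn_Delta_least(2)[OF n], unfold heilbronn_bound_def, intro allI impI)
    fix P :: "(real, 'd) vec set"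
    assume P: "finite P" "card P = n" "P \<subseteq> unit_cube"
    have diam: "norm (x - y) \<le> B" if "x \<in> P" "y \<in> P" for x y
    proof -
      have "x \<in> unit_cube" "y \<in> unit_cube" using that P(3) by blast+
      then have "\<bar>(x - y) $ i\<bar> \<le> 1" for i
        unfolding unit_cube_def mem_Collect_eq vector_minus_component abs_le_iff
        by (smt (verit, best))
      then have "(\<Sum>i\<in>UNIV. \<bar>(x - y) $ i\<bar>) \<le> (\<Sum>i\<in>(UNIV::'d set). 1)" by (intro sum_mono)
      then show ?thesis using norm_le_l1_cart[of "x - y"] by (simp add: B_def d_def)
    qed
    define \<delta> where "\<delta> = 4 * real d * real n powr (- (1 / real d))"
    obtain T where T: "T \<subseteq> P" "card T = 3"
      and close0: "\<And>x y. x \<in> T \<Longrightarrow> y \<in> T \<Longrightarrow> dist x y \<le> 2 * real d * (real n / 2) powr (- (1 / real d))"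
    proof (rule clustered_points[OF P(1,3), of 2])
      show "2 < card P" using P(2) n d4' by simp
    qed (auto simp: P(2) d_def)
    \<comment> \<open>The grid gives the scale \<open>n / 2\<close>, as three points in a cell exceed \<open>t = 2\<close>; the 2 is absorbed into \<open>\<delta>\<close>.\<close>
    have "(1/2) powr (- (1 / real d)) = 2 powr (1 / real d)"
      by (simp add: powr_minus powr_divide)
    also have "\<dots> \<le> 2 powr 1" using d4' by (intro powr_mono) auto
    finally have "(real n / 2) powr (- (1 / real d)) \<le> 2 * real n powr (- (1 / real d))"
      using powr_mult[of "1/2" "real n" "- (1 / real d)"] by (simp add: mult_right_mono)
    then have "2 * real d * (real n / 2) powr (- (1 / real d)) \<le> \<delta>"
      unfolding \<delta>_def using mult_left_mono[of _ _ "2 * real d"] by fastforce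
    then have close: "dist x y \<le> \<delta>" if "x \<in> T" "y \<in> T" for x y
      using close0[OF that] by linarith
    obtain p p1 p2 where pT: "T = {p, p1, p2}" using T(2) by (auto simp: card_3_iff)
    have pP: "p \<in> P" using T(1) pT by auto
    have c2: "card {p1 - p, p2 - p} \<le> 2" by (simp add: card_insert_le_m1)
    then have "card {p1 - p, p2 - p} < DIM((real, 'd) vec)" using d4 by simp
    then obtain a where a: "norm a = 1" "\<And>s. s \<in> {p1 - p, p2 - p} \<Longrightarrow> a \<bullet> s = 0"
      using exists_unit_orthogonal[of "{p1 - p, p2 - p}"] by blast
    have "card {a, p1 - p, p2 - p} \<le> 3" using c2 card_insert_le_m1[of 3 "{p1 - p, p2 - p}" a] by simp
    then have "card {a, p1 - p, p2 - p} < DIM((real, 'd) vec)" using d4 by simp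
    then obtain b where b: "norm b = 1" "\<And>s. s \<in> {a, p1 - p, p2 - p} \<Longrightarrow> b \<bullet> s = 0"
      using exists_unit_orthogonal[of "{a, p1 - p, p2 - p}"] by blast
    have cQ: "card (P - T) = n - 3" using T P by (simp add: card_Diff_subset finite_subset)
    define \<epsilon> where "\<epsilon> = 16 * pi * B * d / real n"
    obtain Q \<theta> where Q: "Q \<subseteq> P - T" "card Q = Suc (d - 2)"
      and near0: "\<And>q. q \<in> Q \<Longrightarrow> \<bar>(cos \<theta> *\<^sub>R a + sin \<theta> *\<^sub>R b) \<bullet> (q - p)\<bar>
        \<le> 8 * pi * B * real (d - 2) / real (card (P - T))"
    proof (rule points_near_pencil_hyperplane[OF a(1) b(1), of "P - T" p B "d - 2"])
      show "finite (P - T)" using P by simp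
      show "norm (q - p) \<le> B" if "q \<in> P - T" for q using that diam pP by blast
      show "0 < d - 2" "d - 2 < card (P - T)" using d4' n cQ by simp_all
    qed blast
    define w where "w = cos \<theta> *\<^sub>R a + sin \<theta> *\<^sub>R b"
    have near: "\<bar>w \<bullet> (q - p)\<bar> \<le> \<epsilon>" if "q \<in> Q" for q
    proof -
      have "real n \<le> 2 * real (n - 3)" using n d4' by simp
      moreover have "0 < real (n - 3)" "0 < real n" using n d4' by simp_all
      ultimately have "1 / real (n - 3) \<le> 2 / real n" by (simp add: field_simps)
      then have "(8 * pi * B) * (real (d - 2) * (1 / real (n - 3))) \<le> (8 * pi * B) * (real d * (2 / real n))"
        by (intro mult_left_mono mult_mono) (auto simp: B_def)
      then show ?thesis using near0[OF that] by (simp add: w_def cQ \<epsilon>_def)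
    qed
    have "w \<bullet> w = (cos \<theta>)\<^sup>2 * (a \<bullet> a) + (sin \<theta>)\<^sup>2 * (b \<bullet> b)"
      using b(2)[of a] by (simp add: w_def inner_commute algebra_simps power2_eq_square)
    then have "norm w = 1" using a(1) b(1) by (simp add: norm_eq_sqrt_inner)
    moreover have "w \<bullet> (x - p) = 0" if "x \<in> T" for x
      using that a(2) b(2) unfolding pT w_def by (auto simp: inner_add_left)
    ultimately have "hull_volume (T \<union> Q) \<le> real (CARD('d) + 2) * (\<epsilon> * \<delta> * B ^ (CARD('d) - 2))"
    proof (intro hull_volume_slab_cluster_le[where p = p])
      show "card Q = CARD('d) - 1" using Q(2) d4' by (simp add: d_def)
      show "finite Q" using Q(1) P(1) finite_subset by blast
      show "T \<inter> Q = {}" using Q(1) by blast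
      show "2 \<le> CARD('d)" using d4 by simp
      show "0 \<le> \<epsilon>" by (simp add: \<epsilon>_def B_def)
      show "norm (x - y) \<le> B" if "x \<in> T \<union> Q" "y \<in> T \<union> Q" for x y
        using that T(1) Q(1) diam by blast
    qed (use T close near pT in auto)
    also have "\<dots> = C * (real n powr (- (1 / real d)) / real n)"
      by (simp add: C_def \<epsilon>_def \<delta>_def d_def)
    also have "real n powr (- (1 / real d)) / real n = real n powr (- (1 / real d) - 1)"
      using n by (simp add: powr_diff)
    also have "- (1 / real d) - 1 = - (1 + 1 / real d)" by simp
    finally have "hull_volume (T \<union> Q) \<le> C * real n powr (- (1 + 1 / real d))" .
    moreover have "card (T \<union> Q) = d + 2"
    proof -
      have "finite T" "finite Q" using T(1) Q(1) P(1) finite_subset by blast+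
      then show ?thesis using T(2) Q d4' by (subst card_Un_disjoint) auto
    qed
    moreover have "T \<union> Q \<subseteq> P" using T Q by blast
    ultimately show "\<exists>S\<subseteq>P. card S = d + 2 \<and> hull_volume S \<le> C * real n powr (- (1 + 1 / real d))"
      by blast
  qed
  ultimately show ?thesis unfolding d_def by blast
qed

theorem proposition1p7:
  shows "\<exists>C::real. C > 0 \<and>
    (\<forall>n::nat. n \<ge> 9 \<longrightarrow> heilbronn_Delta TYPE(7) 9 n \<le> C * real n powr (- (23 / 21)))"
proof -
  obtain C :: real where C: "C > 0"
    "\<And>n. n \<ge> 9 \<Longrightarrow> heilbronn_Delta TYPE(7) 9 n \<le> C * real n powr (- (8 / 7))"
    using heilbronn_Delta_le[where 'd = 7] by auto
  have "heilbronn_Delta TYPE(7) 9 n \<le> C * real n powr (- (23 / 21))" if "n \<ge> 9" for n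
  proof -
    have "C * real n powr (- (8 / 7)) \<le> C * real n powr (- (23 / 21))"
      using C(1) that by (intro mult_left_mono powr_mono) auto
    with C(2)[OF that] show ?thesis by linarith
  qed
  with C(1) show ?thesis by blast
qed

end
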